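(* For $0\le i\le k<n$ we have the identity $$\check\Phi(n,k+1,i)=\check\Phi(n,k,i)+\check\Phi(n,k+1,i+1).$$
   Context: A quasi-graded poset $(P,\rho,\bar\zeta)$ consists of a finite poset $P$, a function $\rho:P\to\mathbb N$ with $x<y\Rightarrow\rho(x)<\rho(y)$, and a function $\bar\zeta$ in the incidence algebra of $P$ with $\bar\zeta(x,x)=1$. Write $\rho(x,y)=\rho(y)-\rho(x)$. If $P$ has minimal element $\hat0$ and maximal element $\hat1$, $\hat0<\hat1$, its $\mathbf{ab}$-index is the polynomial in non-commuting variables $\mathbf a,\mathbf b$ $$\Psi(P)=\sum\bar\zeta(x_0,x_1)\cdots\bar\zeta(x_{k-1},x_k)\cdot(\mathbf a-\mathbf b)^{\rho(x_0,x_1)-1}\,\mathbf b\,(\mathbf a-\mathbf b)^{\rho(x_1,x_2)-1}\,\mathbf b\cdots\mathbf b\,(\mathbf a-\mathbf b)^{\rho(x_{k-1},x_k)-1},$$ summed over all chains $\hat0=x_0<x_1<\cdots<x_k=\hat1$. Semisuspension. For $n\ge1$ and a finite simplicial complex $\Delta$ (containing $\emptyset$) with $\dim\Delta<n$, $\mathrm{Semi}(\Delta,n)$ is obtained by embedding $\Delta$ in the boundary of an $n$-ball; its face poset $\mathcal F(\mathrm{Semi}(\Delta,n))$ is the following quasi-graded poset, independent of the embedding: the elements are the faces of $\Delta$ (with $\hat0=\emptyset$) and two further elements $*$ and $\hat1$; $\rho(F)=\dim F+1$, $\rho( * )=n$, $\rho(\hat1)=n+1$; faces are ordered by inclusion,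 every other element is $<\hat1$, and $F<*$ for every face $F$ with $\rho(F)<n$ (faces of dimension $n-1$ are incomparable to $*$); $$\bar\zeta(F,* )=1+(-1)^{n-\rho(F)}\,\widetilde\chi(\mathrm{link}_\Delta(F)),\qquad\widetilde\chi(\mathrm{link}_\Delta(F))=\sum_{H\in\Delta,\,H\supseteq F}(-1)^{\dim H-\dim F-1},$$ and $\bar\zeta=1$ on all other intervals. For $0\le i\le k$, $\Delta_{k,i}$ is the simplicial complex generated by $i+1$ of the facets of the $k$-dimensional simplex (so $\dim\Delta_{k,i}=k-1$, and $\Delta_{0,0}=\{\emptyset\}$). For $0\le i\le k\le n$ let $P_{n,k,i}=\mathcal F(\mathrm{Semi}(\Delta_{k,i},n))$. The $\mathbf{cd}$-indexes of the simplicial shelling components are $\check\Phi(n,k,0)=\Psi(P_{n,k,0})$ and $\check\Phi(n,k,i)=\Psi(P_{n,k,i})-\Psi(P_{n,k,i-1})$ for $1\le i\le k\le n$. *)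

theory Defs
  imports "HOL-Algebra.Order" "HOL-Library.Poly_Mapping"
begin

section \<open>Polynomials in non-commuting variables\<close>

text \<open>The free monoid of words, written additively so that \<open>'v word \<Rightarrow>\<^sub>0 'c\<close>, with the convolution
  product of the library, is the ring of polynomials over \<open>'c\<close> in the non-commuting variables \<open>'v\<close>.\<close>

datatype 'v word = Word "'v list"

instantiation word :: (type) monoid_add
begin

definition zero_word :: "'a word" where
  "0 = Word []"

fun plus_word :: "'a word \<Rightarrow> 'a word \<Rightarrow> 'a word" where
  "Word u + Word v = Word (u @ v)"

instance
proof
  fix u v w :: "'a word"
  show "u + v + w = u + (v + w)" by (cases u; cases v; cases w) simp
  show "0 + u = u" by (cases u) (simp add: zero_word_def)
  show "u + 0 = u" by (cases u) (simp add: zero_word_def)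
qed

end

type_synonym ('v, 'c) ncpoly = "'v word \<Rightarrow>\<^sub>0 'c"

definition ncvar :: "'v \<Rightarrow> ('v, 'c::comm_ring_1) ncpoly" where
  "ncvar v = Poly_Mapping.single (Word [v]) 1"

definition ncconst :: "'c::comm_ring_1 \<Rightarrow> ('v, 'c) ncpoly" where
  "ncconst c = Poly_Mapping.single 0 c"

datatype ab = A | B

abbreviation var_a :: "(ab, 'c::comm_ring_1) ncpoly" where "var_a \<equiv> ncvar A"
abbreviation var_b :: "(ab, 'c::comm_ring_1) ncpoly" where "var_b \<equiv> ncvar B"


section \<open>Quasi-graded posets and their ab-index\<close>

text \<open>Only the values of \<open>zetabar\<close> on pairs \<open>x \<sqsubseteq> y\<close> carry information: an element of the incidence
  algebra is a function on the intervals of the poset.\<close>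

record ('a, 'c) qgposet = "'a gorder" +
  rho :: "'a \<Rightarrow> nat"
  zetabar :: "'a \<Rightarrow> 'a \<Rightarrow> 'c"

locale quasi_graded_poset = partial_order P
  for P :: "('a, 'c::comm_ring_1) qgposet" (structure) +
  assumes finite_carrier: "finite (carrier P)"
    and rho_less: "\<lbrakk>x \<in> carrier P; y \<in> carrier P; x \<sqsubset> y\<rbrakk> \<Longrightarrow> rho P x < rho P y"
    and zetabar_refl: "x \<in> carrier P \<Longrightarrow> zetabar P x x = 1"

definition bounded_chains :: "('a, 'c) qgposet \<Rightarrow> 'a list set" where
  "bounded_chains P = {xs. xs \<noteq> [] \<and> set xs \<subseteq> carrier P \<and> sorted_wrt (\<lambda>x y. x \<sqsubset>\<^bsub>P\<^esub> y) xs
     \<and> hd xs = \<bottom>\<^bsub>P\<^esub> \<and> last xs = \<top>\<^bsub>P\<^esub>}"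

fun chain_zeta :: "('a, 'c::comm_ring_1) qgposet \<Rightarrow> 'a list \<Rightarrow> 'c" where
  "chain_zeta P (x # y # xs) = zetabar P x y * chain_zeta P (y # xs)"
| "chain_zeta P _ = 1"

fun chain_word :: "('a, 'c::comm_ring_1) qgposet \<Rightarrow> 'a list \<Rightarrow> (ab, 'c) ncpoly" where
  "chain_word P [x, y] = (var_a - var_b) ^ (rho P y - rho P x - 1)"
| "chain_word P (x # y # z # xs) =
     (var_a - var_b) ^ (rho P y - rho P x - 1) * var_b * chain_word P (y # z # xs)"
| "chain_word P _ = 1"

definition ab_index :: "('a, 'c::comm_ring_1) qgposet \<Rightarrow> (ab, 'c) ncpoly" where
  "ab_index P = (\<Sum>xs\<in>bounded_chains P. ncconst (chain_zeta P xs) * chain_word P xs)"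


section \<open>Simplicial complexes and semisuspensions\<close>

text \<open>An abstract simplicial complex is the set of its faces, including the empty one;
  a face \<open>F\<close> has dimension \<open>card F - 1\<close>.\<close>

definition finite_simplicial_complex :: "'v set set \<Rightarrow> bool" where
  "finite_simplicial_complex \<Delta> \<longleftrightarrow> finite \<Delta> \<and> {} \<in> \<Delta> \<and>
     (\<forall>F\<in>\<Delta>. finite F \<and> (\<forall>G. G \<subseteq> F \<longrightarrow> G \<in> \<Delta>))"

definition link :: "'v set set \<Rightarrow> 'v set \<Rightarrow> 'v set set" where
  "link \<Delta> F = {G \<in> \<Delta>. G \<inter> F = {} \<and> G \<union> F \<in> \<Delta>}"

text \<open>The sign of a face \<open>G\<close> is \<open>(-1)\<close> to the power \<open>dim G = card G - 1\<close>, which has the parity of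
  \<open>card G + 1\<close>.\<close>

definition reduced_euler :: "'v set set \<Rightarrow> 'c::comm_ring_1" where
  "reduced_euler \<Delta> = (\<Sum>G\<in>\<Delta>. (- 1) ^ (card G + 1))"

lemma reduced_euler_link:
  assumes \<Delta>: "finite_simplicial_complex \<Delta>" and F: "F \<in> \<Delta>"
  shows "reduced_euler (link \<Delta> F) =
           (\<Sum>H\<in>{H \<in> \<Delta>. F \<subseteq> H}. (- 1 :: 'c::comm_ring_1) ^ (card H - card F + 1))"
  unfolding reduced_euler_def
proof (rule sum.reindex_bij_witness[where i = "\<lambda>H. H - F" and j = "\<lambda>G. G \<union> F"])
  fix G assume G: "G \<in> link \<Delta> F"
  then show "G \<union> F - F = G" "G \<union> F \<in> {H \<in> \<Delta>. F \<subseteq> H}"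
    by (auto simp: link_def)
  have "card (G \<union> F) = card G + card F"
    using G F \<Delta> by (intro card_Un_disjoint) (auto simp: link_def finite_simplicial_complex_def)
  then show "(- 1 :: 'c) ^ (card (G \<union> F) - card F + 1) = (- 1) ^ (card G + 1)"
    by simp
next
  fix H assume H: "H \<in> {H \<in> \<Delta>. F \<subseteq> H}"
  then show "H - F \<union> F = H" by auto
  have "H - F \<in> \<Delta>" using H \<Delta> by (auto simp: finite_simplicial_complex_def)
  moreover have "H - F \<union> F = H" using H by auto
  ultimately show "H - F \<in> link \<Delta> F" using H by (auto simp: link_def)
qed

datatype 'v semi_face = Face "'v set" | Star | Top

fun semi_le :: "nat \<Rightarrow> 'v semi_face \<Rightarrow> 'v semi_face \<Rightarrow> bool" where
  "semi_le n (Face F) (Face G) \<longleftrightarrow> F \<subseteq> G"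
| "semi_le n (Face F) Star \<longleftrightarrow> card F < n"
| "semi_le n Star (Face F) \<longleftrightarrow> False"
| "semi_le n Star Star \<longleftrightarrow> True"
| "semi_le n Top x \<longleftrightarrow> x = Top"
| "semi_le n _ Top \<longleftrightarrow> True"

fun semi_rho :: "nat \<Rightarrow> 'v semi_face \<Rightarrow> nat" where
  "semi_rho n (Face F) = card F"
| "semi_rho n Star = n"
| "semi_rho n Top = n + 1"

fun semi_zeta :: "'v set set \<Rightarrow> nat \<Rightarrow> 'v semi_face \<Rightarrow> 'v semi_face \<Rightarrow> 'c::comm_ring_1" where
  "semi_zeta \<Delta> n (Face F) Star = 1 + (- 1) ^ (n - card F) * reduced_euler (link \<Delta> F)"
| "semi_zeta \<Delta> n _ _ = 1"

text \<open>The face poset of the semisuspension; meaningful for a finite simplicial complex \<open>\<Delta>\<close> all of whose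
  faces have at most \<open>n\<close> vertices, with \<open>n \<ge> 1\<close>.\<close>

definition semi_poset :: "'v set set \<Rightarrow> nat \<Rightarrow> ('v semi_face, 'c::comm_ring_1) qgposet" where
  "semi_poset \<Delta> n = \<lparr>carrier = Face ` \<Delta> \<union> {Star, Top}, eq = (=), le = semi_le n,
     rho = semi_rho n, zetabar = semi_zeta \<Delta> n\<rparr>"

locale semisuspension =
  fixes \<Delta> :: "'v set set" and n :: nat
  assumes complex: "finite_simplicial_complex \<Delta>"
    and card_le: "F \<in> \<Delta> \<Longrightarrow> card F \<le> n"
    and n_pos: "1 \<le> n"
begin

lemma finite_face: "F \<in> \<Delta> \<Longrightarrow> finite F"
  using complex by (auto simp: finite_simplicial_complex_def)

lemma partial_order_semi: "partial_order (semi_poset \<Delta> n :: (_, 'c::comm_ring_1) qgposet)"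
  (is "partial_order ?P")
proof
  fix x y z :: "'v semi_face"
  assume *: "x \<sqsubseteq>\<^bsub>?P\<^esub> y" "y \<sqsubseteq>\<^bsub>?P\<^esub> z"
    and c: "x \<in> carrier ?P" "y \<in> carrier ?P"
      "z \<in> carrier ?P"
  show "x \<sqsubseteq>\<^bsub>?P\<^esub> z"
  proof (cases "\<exists>F G. x = Face F \<and> y = Face G \<and> z = Star")
    case True
    then obtain F G where FG: "x = Face F" "y = Face G" "z = Star" by blast
    with c have "finite G" by (auto simp: semi_poset_def finite_face)
    then have "card F \<le> card G" using * FG by (intro card_mono) (auto simp: semi_poset_def)
    then show ?thesis using * FG by (auto simp: semi_poset_def)
  next
    case False
    then show ?thesis using * c
      by (cases x; cases y; cases z) (auto simp: semi_poset_def)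
  qed
next
  fix x assume "x \<in> carrier ?P"
  then show "x \<sqsubseteq>\<^bsub>?P\<^esub> x" by (cases x) (auto simp: semi_poset_def)
next
  fix x y :: "'v semi_face"
  assume "x \<sqsubseteq>\<^bsub>?P\<^esub> y" "y \<sqsubseteq>\<^bsub>?P\<^esub> x"
  then show "x .=\<^bsub>?P\<^esub> y"
    by (cases x; cases y) (auto simp: semi_poset_def)
qed (auto simp: semi_poset_def)

lemma quasi_graded_semi: "quasi_graded_poset (semi_poset \<Delta> n :: (_, 'c::comm_ring_1) qgposet)"
  (is "quasi_graded_poset ?P")
proof -
  interpret partial_order "?P" by (rule partial_order_semi)
  show ?thesis
  proof
    show "finite (carrier ?P)"
      using complex by (auto simp: semi_poset_def finite_simplicial_complex_def)
  next
    fix x y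
    assume c: "x \<in> carrier ?P" "y \<in> carrier ?P"
      and xy: "x \<sqsubset>\<^bsub>?P\<^esub> y"
    then show "rho ?P x < rho ?P y"
      by (cases x; cases y)
        (auto simp: semi_poset_def lless_def less_Suc_eq_le card_le intro!: psubset_card_mono finite_face)
  next
    fix x assume "x \<in> carrier ?P"
    then show "zetabar ?P x x = 1" by (cases x) (auto simp: semi_poset_def)
  qed
qed

lemma bottom_semi: "\<bottom>\<^bsub>(semi_poset \<Delta> n :: (_, 'c::comm_ring_1) qgposet)\<^esub> = Face {}"
  (is "\<bottom>\<^bsub>?P\<^esub> = _")
proof -
  interpret partial_order "?P" by (rule partial_order_semi)
  have "least ?P (Face {}) (carrier ?P)"
    using complex n_pos by (auto simp: least_def semi_poset_def finite_simplicial_complex_def)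
  then show ?thesis
    unfolding bottom_def by (rule some_equality) (metis \<open>least _ _ _\<close> least_unique)
qed

lemma top_semi: "\<top>\<^bsub>(semi_poset \<Delta> n :: (_, 'c::comm_ring_1) qgposet)\<^esub> = Top"
  (is "\<top>\<^bsub>?P\<^esub> = _")
proof -
  interpret partial_order "?P" by (rule partial_order_semi)
  have "greatest ?P Top (carrier ?P)"
    by (auto simp: greatest_def semi_poset_def)
  then show ?thesis
    unfolding top_def by (rule some_equality) (metis \<open>greatest _ _ _\<close> greatest_unique)
qed

end


section \<open>The simplicial shelling components\<close>

definition generated_complex :: "'v set set \<Rightarrow> 'v set set" where
  "generated_complex \<G> = {F. \<exists>G\<in>\<G>. F \<subseteq> G}"

text \<open>The \<open>k\<close>-dimensional simplex has vertices \<open>0, \<dots>, k\<close>; its facets are the sets \<open>{..k} - {j}\<close> with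
  \<open>j \<le> k\<close>. By symmetry it does not matter which \<open>i + 1\<close> of them are chosen.\<close>

definition shelling_complex :: "nat \<Rightarrow> nat \<Rightarrow> nat set set" where
  "shelling_complex k i = generated_complex ((\<lambda>j. {..k} - {j}) ` {..i})"

lemma semisuspension_shelling_complex:
  assumes "i \<le> k" "k \<le> n" "1 \<le> n"
  shows "semisuspension (shelling_complex k i) n"
proof
  show "finite_simplicial_complex (shelling_complex k i)"
    unfolding finite_simplicial_complex_def
  proof (intro conjI ballI allI impI)
    have "shelling_complex k i \<subseteq> Pow {..k}"
      by (auto simp: shelling_complex_def generated_complex_def)
    then show "finite (shelling_complex k i)" by (rule finite_subset) simp
  qed (auto simp: shelling_complex_def generated_complex_def intro: finite_subset)
next
  fix F assume "F \<in> shelling_complex k i"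
  then obtain j where "j \<le> i" "F \<subseteq> {..k} - {j}"
    by (auto simp: shelling_complex_def generated_complex_def)
  then have "card F \<le> card ({..k} - {j})" by (intro card_mono) auto
  also have "\<dots> = k" using \<open>j \<le> i\<close> assms by simp
  finally show "card F \<le> n" using assms by simp
qed (use assms in simp)

definition shelling_poset :: "nat \<Rightarrow> nat \<Rightarrow> nat \<Rightarrow> (nat semi_face, 'c::comm_ring_1) qgposet" where
  "shelling_poset n k i = semi_poset (shelling_complex k i) n"

text \<open>The \<open>cd\<close>-index is the \<open>ab\<close>-index itself, read as a polynomial in \<open>c = a + b\<close> and
  \<open>d = ab + ba\<close>.\<close>

definition shelling_component :: "nat \<Rightarrow> nat \<Rightarrow> nat \<Rightarrow> (ab, 'c::comm_ring_1) ncpoly" where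
  "shelling_component n k i =
     (if i = 0 then ab_index (shelling_poset n k 0)
      else ab_index (shelling_poset n k i) - ab_index (shelling_poset n k (i - 1)))"

end

theory Submission
  imports Defs
begin

text \<open>The faces below a face \<open>F\<close> form a Boolean algebra, so the chains from \<open>\<emptyset>\<close> to \<open>F\<close> contribute a
  polynomial that depends only on \<open>card F\<close>. The only other dependence on the complex is through the
  reduced Euler characteristics of the links, and summing these over all faces of a given size and
  exchanging the order of summation gives a combination of face numbers. Hence the \<open>ab\<close>-index of
  \<open>Semi(\<Delta>, n)\<close> is a sum \<open>\<Sum>H\<in>\<Delta>. K (card H)\<close> with \<open>K\<close> independent of \<open>\<Delta>\<close>. The faces of
  \<open>\<Delta>\<^bsub>k,i\<^esub>\<close> that are not in \<open>\<Delta>\<^bsub>k,i-1\<^esub>\<close> are the sets \<open>{..<i} \<union> S\<close> with \<open>S \<subseteq> {i<..k}\<close>, and the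
  identity becomes Pascal's rule: split the \<open>S \<subseteq> {i<..k + 1}\<close> according to whether \<open>k + 1 \<in> S\<close>.\<close>

text \<open>Grouping the subsets by size shows that the sum depends on \<open>S\<close> only through
  \<open>card S\<close>.\<close>

lemma sum_Pow_card:
  fixes f :: "nat \<Rightarrow> 'b::semiring_1"
  assumes "finite S"
  shows "(\<Sum>T\<in>Pow S. f (card T)) = (\<Sum>m\<le>card S. of_nat (card S choose m) * f m)"
proof -
  have "(\<Sum>T\<in>Pow S. f (card T)) = (\<Sum>m\<le>card S. \<Sum>T\<in>{T \<in> Pow S. card T = m}. f (card T))"
    by (rule sum.group[symmetric]) (use assms in \<open>auto intro: card_mono\<close>)
  also have "\<dots> = (\<Sum>m\<le>card S. of_nat (card S choose m) * f m)"
    using n_subsets[OF assms] by (intro sum.cong) (auto simp: Pow_def)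
  finally show ?thesis .
qed

lemma ncconst_add: "ncconst (c + d) = ncconst c + ncconst d"
  by (simp add: ncconst_def single_add)

lemma ncconst_0 [simp]: "ncconst 0 = 0"
  by (simp add: ncconst_def)

lemma ncconst_1 [simp]: "ncconst 1 = 1"
  by (simp add: ncconst_def)

lemma ncconst_sum: "ncconst (sum f S) = (\<Sum>x\<in>S. ncconst (f x))"
  by (induction S rule: infinite_finite_induct) (auto simp: ncconst_add)


section \<open>Flags of faces\<close>

text \<open>Chains from \<emptyset> to \<open>F\<close> in the Boolean algebra of subsets of
  \<open>F\<close>. No complex occurs here: being closed under subsets, a complex that contains
  \<open>F\<close> contains every member of such a flag.\<close>

definition flags :: "'v set \<Rightarrow> 'v set list set" where
  "flags F = {Fs. Fs \<noteq> [] \<and> hd Fs = {} \<and> last Fs = F \<and> sorted_wrt (\<subset>) Fs}"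

text \<open>In contrast to \<open>chain_word\<close>, the last step too is followed by
  \<open>var_b\<close>: in a semisuspension a chain always continues beyond its last face.\<close>

fun flag_word :: "'v set list \<Rightarrow> (ab, 'c::comm_ring_1) ncpoly" where
  "flag_word (F # G # Fs) = (var_a - var_b) ^ (card G - card F - 1) * var_b * flag_word (G # Fs)"
| "flag_word _ = 1"

text \<open>The set \<open>{..<m}\<close> represents all sets with \<open>m\<close> elements;
  \<open>sum_flag_word\<close> shows that any other gives the same sum.\<close>

definition flag_sum :: "nat \<Rightarrow> (ab, 'c::comm_ring_1) ncpoly" where
  "flag_sum m = (\<Sum>Fs\<in>flags {..<m}. flag_word Fs)"

lemma flags_subset: "Fs \<in> flags F \<Longrightarrow> G \<in> set Fs \<Longrightarrow> G \<subseteq> F"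
  by (cases Fs rule: rev_cases) (auto simp: flags_def sorted_wrt_append)

lemma finite_flags:
  assumes "finite F"
  shows "finite (flags F)"
proof (rule finite_subset)
  have "distinct Fs" if "sorted_wrt (\<subset>) Fs" for Fs :: "'a set list"
    using that by (induction Fs) auto
  then show "flags F \<subseteq> {Fs. set Fs \<subseteq> Pow F \<and> distinct Fs}"
    using flags_subset by (fastforce simp: flags_def)
  show "finite {Fs. set Fs \<subseteq> Pow F \<and> distinct Fs}"
    using assms by (intro finite_subset_distinct) simp
qed

text \<open>Injectivity on \<open>F\<close> keeps the inclusions strict.\<close>

lemma map_image_in_flags:
  assumes f: "inj_on f F" and Fs: "Fs \<in> flags F"
  shows "map ((`) f) Fs \<in> flags (f ` F)"
proof -
  have "sorted_wrt (\<lambda>G H. f ` G \<subset> f ` H) Fs"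
  proof (rule sorted_wrt_mono_rel)
    show "sorted_wrt (\<subset>) Fs" using Fs by (simp add: flags_def)
    fix G H assume "G \<in> set Fs" "H \<in> set Fs" "G \<subset> H"
    then show "f ` G \<subset> f ` H"
      using flags_subset[OF Fs] f by (metis inj_on_image_eq_iff image_mono psubset_eq)
  qed
  then show ?thesis
    using Fs by (auto simp: flags_def hd_map last_map sorted_wrt_map)
qed

lemma flag_word_map_image:
  assumes "inj_on f F" "\<And>G. G \<in> set Fs \<Longrightarrow> G \<subseteq> F"
  shows "flag_word (map ((`) f) Fs) = flag_word Fs"
  using assms(2)
proof (induction Fs rule: flag_word.induct)
  case (1 G H Fs)
  have "card (f ` G) = card G" "card (f ` H) = card H"
    using 1 assms(1) by (auto intro!: card_image intro: inj_on_subset)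
  then show ?case using 1 by simp
qed auto

text \<open>A bijection from \<open>F\<close> onto \<open>{..<card F}\<close> carries flags to flags
  and preserves the sizes of their members, which are all that \<open>flag_word\<close> depends
  on.\<close>

lemma sum_flag_word:
  assumes "finite F"
  shows "(\<Sum>Fs\<in>flags F. flag_word Fs) = flag_sum (card F)"
  unfolding flag_sum_def
proof -
  obtain f where f: "bij_betw f F {..<card F}"
    using assms ex_bij_betw_finite_nat[of F] by (auto simp: atLeast0LessThan)
  let ?g = "the_inv_into F f"
  have fi: "inj_on f F" and fF: "f ` F = {..<card F}"
    using f by (auto simp: bij_betw_def)
  have gi: "inj_on ?g {..<card F}" and gF: "?g ` {..<card F} = F"
    using bij_betw_the_inv_into[OF f] by (auto simp: bij_betw_def)
  have gf: "?g ` f ` G = G" if "G \<subseteq> F" for G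
    using that fi by (force simp: image_image the_inv_into_f_f subset_iff)
  have fg: "f ` ?g ` G = G" if "G \<subseteq> {..<card F}" for G
    using that fi fF by (force simp: image_image f_the_inv_into_f subset_iff)
  show "(\<Sum>Fs\<in>flags F. flag_word Fs) = (\<Sum>Fs\<in>flags {..<card F}. flag_word Fs :: (ab, 'b) ncpoly)"
  proof (rule sum.reindex_bij_witness[where i = "map ((`) ?g)" and j = "map ((`) f)"])
    fix Fs assume Fs: "Fs \<in> flags F"
    show "map ((`) ?g) (map ((`) f) Fs) = Fs"
      using flags_subset[OF Fs] gf by (simp add: map_idI)
    show "map ((`) f) Fs \<in> flags {..<card F}"
      using map_image_in_flags[OF fi Fs] fF by simp
    show "flag_word (map ((`) f) Fs) = (flag_word Fs :: (ab, 'b) ncpoly)"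
      by (rule flag_word_map_image[OF fi]) (use flags_subset[OF Fs] in blast)
  next
    fix Fs assume Fs: "Fs \<in> flags {..<card F}"
    show "map ((`) f) (map ((`) ?g) Fs) = Fs"
      using flags_subset[OF Fs] fg by (simp add: map_idI)
    show "map ((`) ?g) Fs \<in> flags F"
      using map_image_in_flags[OF gi Fs] gF by simp
  qed
qed

text \<open>The product splits at the last face. Since \<open>xs\<close> is nonempty, that face does
  not end the chain, so each step between faces is followed by \<open>var_b\<close>, as in
  \<open>flag_word\<close>.\<close>

lemma chain_word_map_Face:
  assumes "Fs \<noteq> []" "xs \<noteq> []"
  shows "chain_word (semi_poset \<Delta> n) (map Face Fs @ xs) =
           flag_word Fs * chain_word (semi_poset \<Delta> n) (Face (last Fs) # xs)"
  using assms(1)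
proof (induction Fs rule: flag_word.induct)
  case (1 F G Fs)
  obtain y ys where "map Face Fs @ xs = y # ys"
    using assms(2) by (cases "map Face Fs @ xs") auto
  then show ?case using 1 by (auto simp: semi_poset_def mult.assoc)
qed auto

text \<open>Between faces \<open>zetabar\<close> is 1, so only the steps after the last face
  matter.\<close>

lemma chain_zeta_map_Face:
  assumes "Fs \<noteq> []"
  shows "chain_zeta (semi_poset \<Delta> n) (map Face Fs @ xs) =
           chain_zeta (semi_poset \<Delta> n) (Face (last Fs) # xs)"
  using assms by (induction Fs rule: flag_word.induct) (auto simp: semi_poset_def)


section \<open>The ab-index of a semisuspension as a function of the face numbers\<close>

text \<open>The contribution of the chains through \<open>Star\<close> whose last face is a given
  one with \<open>m\<close> vertices, up to the factor \<open>zetabar\<close>. The step from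
  \<open>Star\<close> to \<open>Top\<close> has exponent \<open>(n + 1) - n - 1 = 0\<close>. Faces
  with \<open>n\<close> vertices are not below \<open>Star\<close>; the value 0 lets sums run over
  all faces.\<close>

definition star_weight :: "nat \<Rightarrow> nat \<Rightarrow> (ab, 'c::comm_ring_1) ncpoly" where
  "star_weight n m = (if m < n then flag_sum m * ((var_a - var_b) ^ (n - m - 1) * var_b) else 0)"

text \<open>The last sum collects, over the faces \<open>F\<close> of a face with \<open>h\<close> vertices, the terms which that
  face contributes to the reduced Euler characteristic of the link of \<open>F\<close>.\<close>

definition face_weight :: "nat \<Rightarrow> nat \<Rightarrow> (ab, 'c::comm_ring_1) ncpoly" where
  "face_weight n h = flag_sum h * (var_a - var_b) ^ (n - h) + star_weight n h
     + (\<Sum>m\<le>h. of_nat (h choose m)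
          * (ncconst ((- 1) ^ (n - m) * (- 1) ^ (h - m + 1)) * star_weight n m))"

context semisuspension
begin

lemma finite_complex: "finite \<Delta>"
  using complex by (simp add: finite_simplicial_complex_def)

lemma Pow_face: "H \<in> \<Delta> \<Longrightarrow> Pow H \<subseteq> \<Delta>"
  using complex by (auto simp: finite_simplicial_complex_def)

text \<open>Only \<open>Top\<close> lies strictly above \<open>Star\<close>, so a chain is a flag of
  its last face followed by \<open>Top\<close>, with \<open>Star\<close> possibly in between if that
  face has fewer than \<open>n\<close> vertices.\<close>

lemma bounded_chains_semi:
  "bounded_chains (semi_poset \<Delta> n :: (_, 'c::comm_ring_1) qgposet) =
     (\<lambda>Fs. map Face Fs @ [Top]) ` (\<Union>F\<in>\<Delta>. flags F) \<union>
     (\<lambda>Fs. map Face Fs @ [Star, Top]) ` (\<Union>F\<in>{F \<in> \<Delta>. card F < n}. flags F)"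
  (is "bounded_chains ?P = ?R")
proof
  have less: "x \<sqsubset>\<^bsub>?P\<^esub> y \<longleftrightarrow> semi_le n x y \<and> x \<noteq> y" for x y
    by (auto simp: semi_poset_def lless_def)
  have carr: "carrier ?P = Face ` \<Delta> \<union> {Star, Top}" by (simp add: semi_poset_def)
  have less_Face: "(\<lambda>F G. Face F \<sqsubset>\<^bsub>?P\<^esub> Face G) = (\<subset>)"
    by (auto simp: less fun_eq_iff)
  have Faces: "\<exists>Fs. ys = map Face Fs \<and> Fs \<in> flags (last Fs) \<and> last Fs \<in> \<Delta>"
    if "set ys \<subseteq> Face ` \<Delta>" "ys \<noteq> []" "hd ys = Face {}" "sorted_wrt (\<lambda>x y. x \<sqsubset>\<^bsub>?P\<^esub> y) ys" for ys
  proof -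
    have "ys \<in> lists (Face ` \<Delta>)" using that(1) by auto
    then obtain Fs where Fs: "ys = map Face Fs" "set Fs \<subseteq> \<Delta>" by (auto simp: lists_image)
    have "last Fs \<in> \<Delta>" using that(2) Fs last_in_set[of Fs] by blast
    then show ?thesis
      using that Fs by (auto simp: flags_def sorted_wrt_map less_Face hd_map)
  qed
  show "bounded_chains ?P \<subseteq> ?R"
  proof
    fix xs assume "xs \<in> bounded_chains ?P"
    then have xs: "xs \<noteq> []" "set xs \<subseteq> Face ` \<Delta> \<union> {Star, Top}"
      "sorted_wrt (\<lambda>x y. x \<sqsubset>\<^bsub>?P\<^esub> y) xs" "hd xs = Face {}" "last xs = Top"
      by (auto simp: bounded_chains_def top_semi bottom_semi carr)
    obtain ys where ys: "xs = ys @ [Top]"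
      using xs(1,5) by (metis append_butlast_last_id)
    have "ys \<noteq> []" using xs(4) ys by auto
    have ys_sorted: "sorted_wrt (\<lambda>x y. x \<sqsubset>\<^bsub>?P\<^esub> y) ys" and "Top \<notin> set ys"
      using xs(3) by (auto simp: ys sorted_wrt_append less)
    then have ys_set: "set ys \<subseteq> Face ` \<Delta> \<union> {Star}" using xs(2) by (auto simp: ys)
    have ys_hd: "hd ys = Face {}" using xs(4) \<open>ys \<noteq> []\<close> by (simp add: ys)
    obtain zs z where zs: "ys = zs @ [z]" using \<open>ys \<noteq> []\<close> by (metis rev_exhaust)
    have zs_less: "semi_le n x z \<and> x \<noteq> z" if "x \<in> set zs" for x
      using ys_sorted that by (auto simp: zs sorted_wrt_append less)
    \<comment> \<open>Every member of \<open>zs\<close> is strictly below \<open>z\<close>, and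
      nothing in \<open>ys\<close> is strictly above \<open>Star\<close>. Hence \<open>Star\<close>
      can occur only as \<open>z\<close>.\<close>
    have zs_set: "set zs \<subseteq> Face ` \<Delta>"
    proof
      fix x assume "x \<in> set zs"
      with zs_less[OF this] ys_set show "x \<in> Face ` \<Delta>" by (cases x; cases z) (auto simp: zs)
    qed
    show "xs \<in> ?R"
    proof (cases "z = Star")
      case False
      then have "set ys \<subseteq> Face ` \<Delta>" using zs_set ys_set by (auto simp: zs)
      from Faces[OF this \<open>ys \<noteq> []\<close> ys_hd ys_sorted] show ?thesis by (auto simp: ys)
    next
      case True
      then have "zs \<noteq> []" using ys_hd by (auto simp: zs)
      moreover have "sorted_wrt (\<lambda>x y. x \<sqsubset>\<^bsub>?P\<^esub> y) zs"
        using ys_sorted by (simp add: zs sorted_wrt_append)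
      ultimately obtain Fs where Fs: "zs = map Face Fs" "Fs \<in> flags (last Fs)" "last Fs \<in> \<Delta>"
        using Faces[OF zs_set] ys_hd by (auto simp: zs)
      have "Face (last Fs) \<in> set zs" using Fs(1) \<open>zs \<noteq> []\<close> by simp
      then have "card (last Fs) < n" using zs_less True by fastforce
      then show ?thesis using Fs True by (auto simp: ys zs)
    qed
  qed
  have flag_faces: "set Fs \<subseteq> \<Delta>" if "Fs \<in> flags F" "F \<in> \<Delta>" for Fs F
    using flags_subset[OF that(1)] Pow_face[OF that(2)] by blast
  have card_flag: "card G \<le> card F" if "Fs \<in> flags F" "F \<in> \<Delta>" "G \<in> set Fs" for Fs F G
    using flags_subset[OF that(1,3)] finite_face[OF that(2)] by (rule card_mono[rotated])
  have flag_sorted: "sorted_wrt (\<lambda>x y. x \<sqsubset>\<^bsub>?P\<^esub> y) (map Face Fs)" if "Fs \<in> flags F" for Fs F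
    using that by (simp add: flags_def sorted_wrt_map less_Face)
  have flag_hd: "Fs \<noteq> []" "hd (map Face Fs @ xs) = Face {}" if "Fs \<in> flags F" for Fs F xs
    using that by (auto simp: flags_def hd_map)
  show "?R \<subseteq> bounded_chains ?P"
  proof (intro Un_least image_subsetI)
    fix Fs assume "Fs \<in> (\<Union>F\<in>\<Delta>. flags F)"
    then obtain F where F: "F \<in> \<Delta>" "Fs \<in> flags F" by blast
    have "sorted_wrt (\<lambda>x y. x \<sqsubset>\<^bsub>?P\<^esub> y) (map Face Fs @ [Top])"
      using flag_sorted[OF F(2)] by (auto simp: sorted_wrt_append less)
    then show "map Face Fs @ [Top] \<in> bounded_chains ?P"
      using flag_faces[OF F(2,1)] flag_hd[OF F(2)]
      by (auto simp: bounded_chains_def top_semi bottom_semi carr)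
  next
    fix Fs assume "Fs \<in> (\<Union>F\<in>{F \<in> \<Delta>. card F < n}. flags F)"
    then obtain F where F: "F \<in> \<Delta>" "card F < n" "Fs \<in> flags F" by blast
    have "sorted_wrt (\<lambda>x y. x \<sqsubset>\<^bsub>?P\<^esub> y) (map Face Fs @ [Star, Top])"
      using flag_sorted[OF F(3)] F(2)
      by (auto simp: sorted_wrt_append less intro: le_less_trans[OF card_flag[OF F(3,1)]])
    then show "map Face Fs @ [Star, Top] \<in> bounded_chains ?P"
      using flag_faces[OF F(3,1)] flag_hd[OF F(3)]
      by (auto simp: bounded_chains_def top_semi bottom_semi carr)
  qed
qed

text \<open>The chains are sorted by their last face \<open>F\<close> and by whether they pass
  through \<open>Star\<close>; in both cases the flags of \<open>F\<close> factor out as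
  \<open>flag_sum (card F)\<close>.\<close>

lemma ab_index_semi_links:
  "(ab_index (semi_poset \<Delta> n) :: (ab, 'c::comm_ring_1) ncpoly) =
     (\<Sum>F\<in>\<Delta>. flag_sum (card F) * (var_a - var_b) ^ (n - card F)
        + ncconst (1 + (- 1) ^ (n - card F) * reduced_euler (link \<Delta> F)) * star_weight n (card F))"
proof -
  let ?P = "semi_poset \<Delta> n :: ('v semi_face, 'c) qgposet"
  let ?t = "\<lambda>xs. ncconst (chain_zeta ?P xs) * chain_word ?P xs"
  let ?D = "{F \<in> \<Delta>. card F < n}"
  have fin: "finite (\<Union>F\<in>D. flags F)" if "D \<subseteq> \<Delta>" for D
    using that finite_complex finite_subset[OF that] by (auto intro!: finite_flags finite_face)
  have inj: "inj_on (\<lambda>Fs. map Face Fs @ ys) S" for S :: "'v set list set" and ys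
    by (auto simp: inj_on_def inj_map_eq_map inj_def)
  \<comment> \<open>Flags of different faces are different, as a flag of \<open>F\<close> ends in
    \<open>F\<close>.\<close>
  have split: "(\<Sum>Fs\<in>(\<Union>F\<in>D. flags F). g Fs) = (\<Sum>F\<in>D. \<Sum>Fs\<in>flags F. g Fs)"
    if "D \<subseteq> \<Delta>" for D and g :: "'v set list \<Rightarrow> (ab, 'c) ncpoly"
    using that finite_subset[OF that finite_complex]
    by (intro sum.UNION_disjoint) (auto intro!: finite_flags finite_face, auto simp: flags_def)
  have top: "?t (map Face Fs @ [Top]) = flag_word Fs * (var_a - var_b) ^ (n - card F)"
    if "Fs \<in> flags F" for F Fs
    using that by (simp add: flags_def chain_word_map_Face chain_zeta_map_Face)
      (auto simp: semi_poset_def)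
  have star: "?t (map Face Fs @ [Star, Top]) =
      ncconst (1 + (- 1) ^ (n - card F) * reduced_euler (link \<Delta> F))
        * (flag_word Fs * ((var_a - var_b) ^ (n - card F - 1) * var_b))"
    if "Fs \<in> flags F" for F Fs
    using that by (simp add: flags_def chain_word_map_Face chain_zeta_map_Face)
      (auto simp: semi_poset_def mult.assoc)
  \<comment> \<open>The two families of chains are disjoint: comparing the underlying sets, only the
    second contains \<open>Star\<close>.\<close>
  have "ab_index ?P =
      (\<Sum>Fs\<in>(\<Union>F\<in>\<Delta>. flags F). ?t (map Face Fs @ [Top])) +
      (\<Sum>Fs\<in>(\<Union>F\<in>?D. flags F). ?t (map Face Fs @ [Star, Top]))"
    unfolding ab_index_def bounded_chains_semi
    by (subst sum.union_disjoint) (auto simp: fin sum.reindex[OF inj] dest!: arg_cong[where f = set])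
  also have "(\<Sum>Fs\<in>(\<Union>F\<in>\<Delta>. flags F). ?t (map Face Fs @ [Top])) =
      (\<Sum>F\<in>\<Delta>. flag_sum (card F) * (var_a - var_b) ^ (n - card F))"
    by (simp add: split top sum_distrib_right[symmetric] sum_flag_word finite_face)
  also have "(\<Sum>Fs\<in>(\<Union>F\<in>?D. flags F). ?t (map Face Fs @ [Star, Top])) =
      (\<Sum>F\<in>?D. ncconst (1 + (- 1) ^ (n - card F) * reduced_euler (link \<Delta> F))
         * star_weight n (card F))"
    by (simp add: split star sum_distrib_right[symmetric] sum_distrib_left[symmetric] sum_flag_word
        finite_face star_weight_def)
  also have "\<dots> = (\<Sum>F\<in>\<Delta>. ncconst (1 + (- 1) ^ (n - card F) * reduced_euler (link \<Delta> F))
         * star_weight n (card F))"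
    by (rule sum.mono_neutral_left) (auto simp: finite_complex star_weight_def)
  finally show ?thesis by (simp add: sum.distrib)
qed

text \<open>The Euler characteristic of the link of \<open>F\<close> is a sum over the faces
  \<open>H\<close> containing \<open>F\<close>. Summing over \<open>F\<close> first collects
  everything at \<open>H\<close>.\<close>

lemma ab_index_semi:
  "(ab_index (semi_poset \<Delta> n) :: (ab, 'c::comm_ring_1) ncpoly) = (\<Sum>H\<in>\<Delta>. face_weight n (card H))"
proof -
  let ?s = "\<lambda>m h. ncconst ((- 1) ^ (n - m) * (- 1) ^ (h - m + 1)) * star_weight n m
     :: (ab, 'c) ncpoly"
  have "(\<Sum>F\<in>\<Delta>. ncconst ((- 1) ^ (n - card F) * reduced_euler (link \<Delta> F)) * star_weight n (card F))
      = (\<Sum>F\<in>\<Delta>. \<Sum>H\<in>{H \<in> \<Delta>. F \<subseteq> H}. ?s (card F) (card H))"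
    by (intro sum.cong)
      (auto simp: reduced_euler_link[OF complex] sum_distrib_left ncconst_sum sum_distrib_right)
  also have "\<dots> = (\<Sum>H\<in>\<Delta>. \<Sum>F\<in>{F \<in> \<Delta>. F \<subseteq> H}. ?s (card F) (card H))"
    by (rule sum.swap_restrict) (auto simp: finite_complex)
  \<comment> \<open>All subsets of \<open>H\<close> are faces, so the inner sum no longer involves
    the complex.\<close>
  also have "\<dots> = (\<Sum>H\<in>\<Delta>. \<Sum>F\<in>Pow H. ?s (card F) (card H))"
    using Pow_face by (intro sum.cong) auto
  also have "\<dots> = (\<Sum>H\<in>\<Delta>. \<Sum>m\<le>card H. of_nat (card H choose m) * ?s m (card H))"
    by (intro sum.cong refl sum_Pow_card finite_face)
  finally show ?thesis
    unfolding ab_index_semi_links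
    by (simp add: face_weight_def ncconst_add distrib_right sum.distrib add.assoc)
qed

end


section \<open>The simplicial shelling components\<close>

text \<open>A set of vertices lies in one of the chosen facets exactly if it omits some vertex
  \<open>j\<close> in \<open>{..i}\<close>.\<close>

lemma shelling_complex_eq:
  "shelling_complex k i = {F. F \<subseteq> {..k} \<and> \<not> {..i} \<subseteq> F}"
  by (auto simp: shelling_complex_def generated_complex_def subset_Diff_insert)

text \<open>For \<open>i > 0\<close>, the sets on the left are the faces added with the facet that
  omits \<open>i\<close>: they contain \<open>{..<i}\<close>, as they were not faces before, and
  they omit \<open>i\<close>.\<close>

lemma new_faces_eq:
  fixes i k :: nat
  assumes "i \<le> k"
  shows "{F. {..<i} \<subseteq> F \<and> F \<subseteq> {..k} - {i}} = (\<union>) {..<i} ` Pow {i<..k}"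
proof (intro subset_antisym subsetI)
  fix F assume F: "F \<in> {F. {..<i} \<subseteq> F \<and> F \<subseteq> {..k} - {i}}"
  have "{..k} - {i} = {..<i} \<union> {i<..k}" using assms by auto
  then have "F = {..<i} \<union> (F \<inter> {i<..k})" using F by blast
  then show "F \<in> (\<union>) {..<i} ` Pow {i<..k}" by (rule image_eqI) simp
qed (use assms in auto)

lemma shelling_component_eq:
  assumes "i \<le> k" "k \<le> n" "1 \<le> n"
  shows "(shelling_component n k i :: (ab, 'c::comm_ring_1) ncpoly) =
           (\<Sum>S\<in>Pow {i<..k}. face_weight n (i + card S))"
proof -
  let ?w = "\<lambda>m. face_weight n m :: (ab, 'c) ncpoly"
  have ab: "ab_index (shelling_poset n k j) = (\<Sum>H\<in>shelling_complex k j. ?w (card H))"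
    if "j \<le> k" for j
    unfolding shelling_poset_def
    by (rule semisuspension.ab_index_semi[OF semisuspension_shelling_complex[OF that assms(2,3)]])
  have fin: "finite (shelling_complex k i)"
    using semisuspension.finite_complex[OF semisuspension_shelling_complex[OF assms]] .
  have "(shelling_component n k i :: (ab, 'c) ncpoly) =
      (\<Sum>H\<in>{F. {..<i} \<subseteq> F \<and> F \<subseteq> {..k} - {i}}. ?w (card H))"
  proof (cases i)
    case 0
    \<comment> \<open>For \<open>i = 0\<close> nothing is subtracted and every face counts as new,
      in accordance with \<open>{..<0} = {}\<close>.\<close>
    have "shelling_complex k i = {F. {..<i} \<subseteq> F \<and> F \<subseteq> {..k} - {i}}"
      using assms by (auto simp: 0 shelling_complex_eq)
    then show ?thesis using ab[of i] by (simp add: shelling_component_def 0)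
  next
    case (Suc j)
    have "shelling_complex k j \<subseteq> shelling_complex k i"
      using Suc by (auto simp: shelling_complex_eq atMost_Suc)
    moreover have "shelling_complex k i - shelling_complex k j = {F. {..<i} \<subseteq> F \<and> F \<subseteq> {..k} - {i}}"
      using assms Suc by (auto simp: shelling_complex_eq atMost_Suc lessThan_Suc_atMost)
    ultimately show ?thesis
      using ab[of i] ab[of j] assms Suc fin
      by (simp add: shelling_component_def sum_diff[symmetric])
  qed
  also have "\<dots> = (\<Sum>S\<in>Pow {i<..k}. ?w (card ({..<i} \<union> S)))"
  proof -
    have "inj_on ((\<union>) {..<i}) (Pow {i<..k})"
      by (rule inj_on_inverseI[where g = "\<lambda>F. F \<inter> {i<..k}"]) auto
    then show ?thesis unfolding new_faces_eq[OF assms(1)] by (simp add: sum.reindex)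
  qed
  also have "\<dots> = (\<Sum>S\<in>Pow {i<..k}. ?w (i + card S))"
  proof (intro sum.cong refl)
    fix S assume "S \<in> Pow {i<..k}"
    then have "card ({..<i} \<union> S) = i + card S"
      by (subst card_Un_disjoint) (auto intro: finite_subset)
    then show "?w (card ({..<i} \<union> S)) = ?w (i + card S)" by simp
  qed
  finally show ?thesis .
qed

theorem proposition14p4:
  fixes n k i :: nat
  assumes "i \<le> k" and "k < n"
  shows "(shelling_component n (k + 1) i :: (ab, 'c::comm_ring_1) ncpoly) =
           shelling_component n k i + shelling_component n (k + 1) (i + 1)"
proof -
  let ?w = "\<lambda>m. face_weight n m :: (ab, 'c) ncpoly"
  let ?S = "{i<..k}"
  have "{i<..k + 1} = insert (k + 1) ?S" using assms by auto
  then have Pow: "Pow {i<..k + 1} = Pow ?S \<union> insert (k + 1) ` Pow ?S"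
    by (simp add: Pow_insert)
  have "shelling_component n (k + 1) i =
      (\<Sum>S\<in>Pow ?S. ?w (i + card S)) + (\<Sum>S\<in>insert (k + 1) ` Pow ?S. ?w (i + card S))"
    using assms by (subst shelling_component_eq, simp, simp, simp, unfold Pow,
        intro sum.union_disjoint) auto
  also have "(\<Sum>S\<in>Pow ?S. ?w (i + card S)) = shelling_component n k i"
    using assms by (simp add: shelling_component_eq)
  \<comment> \<open>The vertex \<open>k + 1\<close> raises the size by one, which turns the offset
    \<open>i\<close> into \<open>i + 1\<close>.\<close>
  also have "(\<Sum>S\<in>insert (k + 1) ` Pow ?S. ?w (i + card S)) = (\<Sum>S\<in>Pow ?S. ?w (i + 1 + card S))"
  proof (subst sum.reindex)
    show "inj_on (insert (k + 1)) (Pow ?S)"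
      by (rule inj_on_inverseI[where g = "\<lambda>S. S - {k + 1}"]) auto
    have "card (insert (k + 1) S) = card S + 1" if "S \<subseteq> ?S" for S
      using that finite_subset[OF that] by (subst card_insert_disjoint) auto
    then show "sum ((\<lambda>S. ?w (i + card S)) \<circ> insert (k + 1)) (Pow ?S) = (\<Sum>S\<in>Pow ?S. ?w (i + 1 + card S))"
      by (intro sum.cong) auto
  qed
  \<comment> \<open>Both \<open>{i<..k}\<close> and \<open>{i + 1<..k + 1}\<close> have
    \<open>k - i\<close> elements, and the sum depends only on this number.\<close>
  also have "\<dots> = (\<Sum>S\<in>Pow {i + 1<..k + 1}. ?w (i + 1 + card S))"
    by (simp add: sum_Pow_card[where f = "\<lambda>m. ?w (i + 1 + m)", simplified])
  also have "\<dots> = shelling_component n (k + 1) (i + 1)"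
    using assms by (simp add: shelling_component_eq)
  finally show ?thesis .
qed

end
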